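(* Let $\gamma=\frac{1+\sqrt5}2$ and $T:[0,1)^2\to[0,1)^2$, $T(x,y)=(y,\{-x+\gamma y\})$ (the map associated with $\lambda=1/\gamma$). Then $\pi(z)$ is finite for all $z\in(\mathbb Z[\gamma]\cap[0,1))^2$, but $\left(T^k\left(\frac14,\frac1{4\gamma^3}\right)\right)_{k\in\mathbb Z}$ is aperiodic.
   Context: $\{u\}=u-\lfloor u\rfloor$ is the fractional part. $T$ is a bijection of $[0,1)^2$. $\pi(z)$ is the least $p\ge1$ with $T^p(z)=z$, and $\pi(z)=\infty$ (the sequence $(T^k(z))_{k\in\mathbb Z}$ is aperiodic) if no such $p$ exists. *)

theory Defs
  imports "HOL-Analysis.Analysis" "HOL-Computational_Algebra.Computational_Algebra"
    "HOL-Library.Extended_Nat"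
begin

definition golden :: real where
  "golden = (1 + sqrt 5) / 2"

definition int_adjoin :: "real \<Rightarrow> real set" where
  "int_adjoin \<alpha> = range (\<lambda>p :: int poly. poly (map_poly of_int p) \<alpha>)"

definition unit_square :: "(real \<times> real) set" where
  "unit_square = {0..<1} \<times> {0..<1}"

text \<open>The map of interest is the restriction of \<open>T\<close> to \<open>unit_square\<close>; the values outside
  the square play no role.\<close>

definition T :: "real \<times> real \<Rightarrow> real \<times> real" where
  "T = (\<lambda>(x, y). (y, frac (- x + golden * y)))"

definition min_period :: "('a \<Rightarrow> 'a) \<Rightarrow> 'a \<Rightarrow> enat" where
  "min_period f z =
     (if \<exists>p\<ge>1. (f ^^ p) z = z then enat (LEAST p. p \<ge> 1 \<and> (f ^^ p) z = z) else \<infinity>)"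

definition int_iterate :: "'a set \<Rightarrow> ('a \<Rightarrow> 'a) \<Rightarrow> int \<Rightarrow> 'a \<Rightarrow> 'a" where
  "int_iterate A f k z =
     (if k \<ge> 0 then (f ^^ nat k) z else (inv_into A f ^^ nat (- k)) z)"

definition aperiodic :: "(int \<Rightarrow> 'a) \<Rightarrow> bool" where
  "aperiodic s \<longleftrightarrow> \<not> (\<exists>p\<ge>1. \<forall>k. s (k + p) = s k)"

lemma golden_squared: "golden * golden = golden + 1"
  by (simp add: golden_def field_simps)

lemma int_adjoin_golden:
  "int_adjoin golden = {of_int a + of_int b * golden | a b :: int. True}"
proof (intro equalityI subsetI)
  fix x assume "x \<in> int_adjoin golden"
  then obtain p :: "int poly" where x: "x = poly (map_poly of_int p) golden"
    by (auto simp: int_adjoin_def)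
  have "\<exists>a b :: int. poly (map_poly of_int p) golden = of_int a + of_int b * golden"
  proof (induction p)
    case 0
    show ?case by (auto intro!: exI[of _ 0])
  next
    case (pCons c p)
    then obtain a b :: int where ab:
      "poly (map_poly of_int p) golden = of_int a + of_int b * golden" by blast
    have "poly (map_poly of_int (pCons c p)) golden
        = of_int c + golden * (of_int a + of_int b * golden)"
      by (simp add: map_poly_pCons ab)
    also have "\<dots> = of_int c + of_int a * golden + of_int b * (golden * golden)"
      by (simp add: algebra_simps)
    also have "\<dots> = of_int (c + b) + of_int (a + b) * golden"
      unfolding golden_squared by (simp add: algebra_simps)
    finally show ?case by blast
  qed
  then show "x \<in> {of_int a + of_int b * golden | a b :: int. True}" using x by auto
next
  fix x assume "x \<in> {of_int a + of_int b * golden | a b :: int. True}"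
  then obtain a b :: int where x: "x = of_int a + of_int b * golden" by auto
  have "x = poly (map_poly of_int [:a, b:]) golden"
    by (simp add: x map_poly_pCons)
  then show "x \<in> int_adjoin golden" unfolding int_adjoin_def by blast
qed

lemma frac_cong: "frac u = frac v" if "u - v \<in> \<int>" for u v :: real
proof -
  from that obtain n :: int where "u = v + of_int n"
    by (metis Ints_cases add.commute diff_add_cancel)
  then show ?thesis by (simp add: frac_def)
qed

lemma bij_betw_T: "bij_betw T unit_square unit_square"
proof -
  define S where "S = (\<lambda>(x, y). (frac (golden * x - y), x :: real))"
  have *: "frac (golden * y - frac (golden * y - x)) = x" if "0 \<le> x" "x < 1" for x y
  proof -
    have "golden * y - frac (golden * y - x) - x \<in> \<int>"
      by (simp add: frac_def)
    then have "frac (golden * y - frac (golden * y - x)) = frac x" by (rule frac_cong)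
    also have "frac x = x" using that by (simp add: frac_eq)
    finally show ?thesis .
  qed
  show ?thesis
    by (rule bij_betw_byWitness[where f' = S])
       (auto simp: unit_square_def T_def S_def * frac_lt_1 add.commute)
qed

text \<open>For a bijection, the two-sided orbit of \<open>z\<close> is aperiodic iff \<open>z\<close> has infinite period.\<close>

lemma aperiodic_int_iterate_iff:
  assumes f: "bij_betw f A A" and z: "z \<in> A"
  shows "aperiodic (\<lambda>k. int_iterate A f k z) \<longleftrightarrow> min_period f z = \<infinity>"
proof -
  let ?g = "inv_into A f"
  have fA: "(f ^^ n) w \<in> A" if "w \<in> A" for n w
    using that f by (induction n) (auto simp: bij_betw_def)
  have gA: "(?g ^^ n) w \<in> A" if "w \<in> A" for n w
    using that bij_betw_inv_into[OF f] by (induction n) (auto simp: bij_betw_def)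
  have step: "int_iterate A f (k + 1) z = f (int_iterate A f k z)" for k
  proof (cases "k \<ge> 0")
    case True
    then show ?thesis by (simp add: int_iterate_def nat_add_distrib)
  next
    case False
    define n where "n = nat (- k - 1)"
    have n: "k = - int n - 1" using False by (simp add: n_def)
    have "f (?g ((?g ^^ n) z)) = (?g ^^ n) z"
      using f gA[OF z] by (simp add: bij_betw_inv_into_right)
    moreover have "nat (- k) = Suc n" using n by simp
    ultimately show ?thesis using n by (cases "n = 0") (auto simp: int_iterate_def)
  qed
  have inA: "int_iterate A f k z \<in> A" for k
    using fA[OF z] gA[OF z] by (simp add: int_iterate_def)
  have inj: "inj_on f A" using f by (simp add: bij_betw_def)
  have "(\<exists>p\<ge>1. \<forall>k. int_iterate A f (k + p) z = int_iterate A f k z)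
      \<longleftrightarrow> (\<exists>p\<ge>1. (f ^^ p) z = z)" (is "?L \<longleftrightarrow> ?R")
  proof
    assume ?L
    then obtain p where p: "p \<ge> 1" "\<And>k. int_iterate A f (k + p) z = int_iterate A f k z"
      by blast
    from p(2)[of 0] p(1) have "(f ^^ nat p) z = z" by (simp add: int_iterate_def)
    then show ?R using p(1) by (intro exI[of _ "nat p"]) auto
  next
    assume ?R
    then obtain p where p: "p \<ge> 1" "(f ^^ p) z = z" by blast
    have "int_iterate A f (k + int p) z = int_iterate A f k z" for k
    proof (induction k rule: int_induct[where k = 0])
      case base
      show ?case using p by (simp add: int_iterate_def)
    next
      case (step1 i)
      then show ?case using step[of i] step[of "i + int p"] by (simp add: algebra_simps)
    next
      case (step2 i)
      have "f (int_iterate A f (i - 1 + int p) z) = f (int_iterate A f (i - 1) z)"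
        using step2 step[of "i - 1"] step[of "i - 1 + int p"] by (simp add: algebra_simps)
      then show ?case using inj inA by (auto dest: inj_onD)
    qed
    then show ?L using p(1) by (intro exI[of _ "int p"]) auto
  qed
  then show ?thesis by (auto simp: aperiodic_def min_period_def)
qed

end

theory Submission
  imports Defs
begin

text \<open>Write \<open>\<gamma>\<close> for the golden ratio. On each of its pieces \<open>T\<close> has the linear part
\<open>(x, y) \<mapsto> (y, \<gamma> y - x)\<close>, a rotation by 36 degrees for the invariant quadratic form
\<open>x\<^sup>2 - \<gamma> x y + y\<^sup>2\<close>. So \<open>T\<close> is a piecewise rotation, and the proof is a renormalization argument.

Every orbit either is finite or enters a small open isosceles triangle next to the corner
\<open>(1, 0)\<close> of the square (\<open>settles_unit_square\<close>). In affine coordinates that turn this triangle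
into \<open>{a > 0, b > 0, a + b < 1}\<close>, a suitable power of \<open>T\<close>, depending on the point, becomes a
simple map (\<open>exchange\<close>, \<open>chart_exchange\<close>): the line \<open>a + \<gamma> b = 1\<close> cuts the triangle into an obtuse and
an acute piece, each is rotated rigidly, and the line itself is reflected. The acute piece is
similar to the whole triangle with ratio \<open>1 / \<gamma>\<close>, and under this similarity (\<open>shrink\<close>) the
dynamics on the acute piece is again the same exchange (\<open>shrink_exchange\<close>). Points that never
enter the acute piece have finite orbits (\<open>finite_orbit_if_avoids_acute\<close>). Hence an infinite orbit
can be followed into the acute piece and pulled back along the similarity, again and again.

Pulling back expands by \<open>\<gamma>\<close>, so on the Galois conjugates of coordinates in \<open>\<int>[\<gamma>]\<close> it contracts
by \<open>1 / \<gamma>\<close>, while the moves of the exchange in between keep a suitable size of the conjugates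
fixed (\<open>conj_bounded_exchange\<close>, \<open>conj_bounded_inverse_shrink\<close>). After finitely many rounds the
conjugates are so small that only the point \<open>(2 - \<gamma>, 2 - \<gamma>)\<close> is left, which is fixed. So no
infinite orbit starts in \<open>\<int>[\<gamma>]\<^sup>2\<close>.

For the point with denominator 4 the pull-backs run through a cycle of three points. If its
orbit were finite, pulling back would strictly decrease the number of points of the orbit
(\<open>card_orbit_shrink\<close>), because the orbit in the acute piece also makes excursions outside; going once
round the cycle gives a contradiction (\<open>infinite_orbit_quarter\<close>).\<close>

section \<open>Finite orbits and accelerated maps\<close>

abbreviation forward_orbit :: "('a \<Rightarrow> 'a) \<Rightarrow> 'a \<Rightarrow> 'a set" where
  "forward_orbit f z \<equiv> range (\<lambda>n. (f ^^ n) z)"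

definition finite_orbit :: "('a \<Rightarrow> 'a) \<Rightarrow> 'a \<Rightarrow> bool" where
  "finite_orbit f z \<longleftrightarrow> finite (forward_orbit f z)"

lemma orbit_subset:
  assumes "z \<in> X" and "\<And>x. x \<in> X \<Longrightarrow> f x \<in> X"
  shows "(f ^^ n) z \<in> X"
  by (induction n) (simp_all add: assms)

lemma finite_orbit_in_finite_set:
  assumes "finite X" "z \<in> X" "\<And>x. x \<in> X \<Longrightarrow> f x \<in> X"
  shows "finite_orbit f z"
proof -
  have "(f ^^ n) z \<in> X" for n using assms(2,3) by (rule orbit_subset)
  then have "forward_orbit f z \<subseteq> X" by blast
  then show ?thesis unfolding finite_orbit_def using assms(1) by (rule finite_subset)
qed

lemma funpow_funpow: "(f ^^ m) ((f ^^ n) z) = (f ^^ (m + n)) z"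
  by (simp add: funpow_add)

lemma orbit_funpow_subset: "forward_orbit f ((f ^^ m) z) \<subseteq> forward_orbit f z"
  by (auto simp: funpow_funpow)

lemma finite_orbit_funpow: "finite_orbit f ((f ^^ m) z) \<longleftrightarrow> finite_orbit f z"
proof
  assume fin: "finite_orbit f ((f ^^ m) z)"
  have "forward_orbit f z
      \<subseteq> (\<lambda>n. (f ^^ n) z) ` {..<m} \<union> forward_orbit f ((f ^^ m) z)"
  proof
    fix y assume "y \<in> forward_orbit f z"
    then obtain n where y: "y = (f ^^ n) z" by auto
    show "y \<in> (\<lambda>n. (f ^^ n) z) ` {..<m} \<union> forward_orbit f ((f ^^ m) z)"
    proof (cases "n < m")
      case False
      then have "y = (f ^^ (n - m)) ((f ^^ m) z)"
        using y by (simp add: funpow_funpow)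
      then show ?thesis by blast
    qed (use y in auto)
  qed
  then show "finite_orbit f z"
    using fin unfolding finite_orbit_def by (meson finite_UnI finite_imageI finite_lessThan finite_subset)
next
  assume "finite_orbit f z"
  then show "finite_orbit f ((f ^^ m) z)"
    unfolding finite_orbit_def by (rule finite_subset[OF orbit_funpow_subset])
qed

lemma finite_orbit_step: "finite_orbit f (f z) \<longleftrightarrow> finite_orbit f z"
  using finite_orbit_funpow[of f 1 z] by simp

lemma finite_orbit_periodic:
  assumes "(f ^^ p) z = z" "p \<ge> 1"
  shows "finite_orbit f z"
proof (rule finite_orbit_in_finite_set)
  show "z \<in> (\<lambda>n. (f ^^ n) z) ` {..<p}" using assms(2) by (intro image_eqI[of _ _ 0]) auto
next
  fix x assume "x \<in> (\<lambda>n. (f ^^ n) z) ` {..<p}"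
  then obtain n where n: "x = (f ^^ n) z" "n < p" by auto
  show "f x \<in> (\<lambda>n. (f ^^ n) z) ` {..<p}"
  proof (cases "Suc n = p")
    case True
    then have "f x = z" using n assms(1) by auto
    then show ?thesis using assms(2) by (intro image_eqI[of _ _ 0]) auto
  qed (use n in \<open>auto intro!: image_eqI[of _ _ "Suc n"]\<close>)
qed simp

text \<open>A finite forward orbit of an injective map is a cycle: the first repetition can be cancelled
back to the starting point. This lets finiteness, which passes freely along orbits and between
a map and its accelerations, take the place of periodicity.\<close>

lemma min_period_finite_iff:
  assumes f: "bij_betw f A A" and z: "z \<in> A"
  shows "min_period f z < \<infinity> \<longleftrightarrow> finite_orbit f z"
proof -
  have fA: "(f ^^ n) z \<in> A" for n
    using z f by (intro orbit_subset) (auto simp: bij_betw_def)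
  have "\<exists>p\<ge>1. (f ^^ p) z = z" if fin: "finite_orbit f z"
  proof -
    have "\<not> inj (\<lambda>n. (f ^^ n) z)"
      using fin finite_imageD infinite_UNIV_nat unfolding finite_orbit_def by blast
    then obtain m n where mn: "m < n" "(f ^^ m) z = (f ^^ n) z"
      unfolding inj_def by (metis nat_neq_iff)
    from mn(2) have "(f ^^ m) z = (f ^^ m) ((f ^^ (n - m)) z)"
      using mn(1) by (simp add: funpow_funpow)
    moreover have "bij_betw (f ^^ m) A A" using f by (rule bij_betw_funpow)
    ultimately have "z = (f ^^ (n - m)) z"
      using fA[of "n - m"] z inj_onD[of "f ^^ m" A z "(f ^^ (n - m)) z"]
      by (simp add: bij_betw_def)
    moreover have "n - m \<ge> 1" using mn(1) by simp
    ultimately show ?thesis by metis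
  qed
  moreover have "finite_orbit f z" if "\<exists>p\<ge>1. (f ^^ p) z = z"
    using that finite_orbit_periodic by metis
  ultimately have "finite_orbit f z \<longleftrightarrow> (\<exists>p\<ge>1. (f ^^ p) z = z)" by blast
  then show ?thesis by (simp add: min_period_def)
qed

lemma orbit_image_subset:
  assumes orb: "\<And>k. h (F ((F ^^ k) w)) = (G ^^ n ((F ^^ k) w)) (h ((F ^^ k) w))"
  shows "h ` forward_orbit F w \<subseteq> forward_orbit G (h w)"
proof -
  have "\<exists>m. h ((F ^^ k) w) = (G ^^ m) (h w)" for k
  proof (induction k)
    case 0
    show ?case by (rule exI[of _ 0]) simp
  next
    case (Suc k)
    then obtain m where "h ((F ^^ k) w) = (G ^^ m) (h w)" by blast
    then have "h ((F ^^ Suc k) w) = (G ^^ (n ((F ^^ k) w) + m)) (h w)"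
      using orb[of k] by (simp add: funpow_add)
    then show ?case by blast
  qed
  then show ?thesis by auto
qed

text \<open>The map \<open>F\<close> performs \<open>n v\<close> steps of \<open>G\<close> at once, seen through the injection \<open>h\<close>. One direction
fills in the finitely many intermediate points of each step; the other one holds since \<open>h\<close> embeds
the orbit of \<open>F\<close> into that of \<open>G\<close>. It is used for \<open>T\<close> against the triangle exchange and for the
exchange against its own copy in the acute piece.\<close>

lemma finite_orbit_accelerated_iff:
  assumes w: "w \<in> A" and FA: "\<And>v. v \<in> A \<Longrightarrow> F v \<in> A"
    and n: "\<And>v. v \<in> A \<Longrightarrow> n v \<ge> 1"
    and hF: "\<And>v. v \<in> A \<Longrightarrow> h (F v) = (G ^^ n v) (h v)"
    and h: "inj_on h A"
  shows "finite_orbit F w \<longleftrightarrow> finite_orbit G (h w)"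
proof -
  let ?O = "forward_orbit F w"
  have orb: "(F ^^ k) w \<in> A" for k using w FA by (rule orbit_subset)
  show ?thesis
  proof
    assume "finite_orbit F w"
    then have fin: "finite ?O" by (simp add: finite_orbit_def)
    let ?X = "\<Union>v\<in>?O. (\<lambda>i. (G ^^ i) (h v)) ` {..<n v}"
    show "finite_orbit G (h w)"
    proof (rule finite_orbit_in_finite_set)
      show "finite ?X" using fin by blast
      have "w \<in> ?O" by (intro image_eqI[of _ _ 0]) auto
      moreover have "h w \<in> (\<lambda>i. (G ^^ i) (h w)) ` {..<n w}"
        using n[OF w] by (intro image_eqI[of _ _ 0]) auto
      ultimately show "h w \<in> ?X" by blast
    next
      fix x assume "x \<in> ?X"
      then obtain v i where v: "v \<in> ?O" and x: "x = (G ^^ i) (h v)" "i < n v" by blast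
      from v obtain k where k: "v = (F ^^ k) w" by blast
      have vA: "v \<in> A" using orb k by simp
      show "G x \<in> ?X"
      proof (cases "Suc i = n v")
        case True
        then have "G x = h (F v)" using x hF[OF vA] by (metis comp_apply funpow.simps(2))
        also have "\<dots> = (G ^^ 0) (h (F v))" by simp
        finally have "G x \<in> (\<lambda>i. (G ^^ i) (h (F v))) ` {..<n (F v)}"
          using n[OF FA[OF vA]] by (metis image_eqI lessThan_iff less_eq_Suc_le One_nat_def)
        moreover have "F v \<in> ?O" using k rangeI[of "\<lambda>k. (F ^^ k) w" "Suc k"] by simp
        ultimately show ?thesis by blast
      next
        case False
        then have "Suc i < n v" "G x = (G ^^ Suc i) (h v)" using x by simp_all
        then show ?thesis using v by blast
      qed
    qed
  next
    assume "finite_orbit G (h w)"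
    moreover have "h ` ?O \<subseteq> forward_orbit G (h w)"
      by (rule orbit_image_subset) (rule hF[OF orb])
    ultimately have "finite (h ` ?O)" unfolding finite_orbit_def by (rule finite_subset[rotated])
    moreover have "inj_on h ?O" using h orb by (auto intro: inj_on_subset)
    ultimately show "finite_orbit F w" unfolding finite_orbit_def by (rule finite_imageD)
  qed
qed

section \<open>Estimates for the golden ratio\<close>

lemma golden_bounds: "8 / 5 < golden" "golden < 81 / 50"
proof -
  have "(2.2 :: real)\<^sup>2 < 5" "(5 :: real) < 2.24\<^sup>2" by (simp_all add: power2_eq_square)
  then have "2.2 < sqrt 5" "sqrt 5 < 2.24"
    by (auto intro: real_less_rsqrt real_less_lsqrt simp del: less_divide_eq_numeral1 divide_less_eq_numeral1)
  then show "8 / 5 < golden" "golden < 81 / 50" by (simp_all add: golden_def)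
qed

lemma golden_mult_bounds:
  assumes "0 < t"
  shows "(8 / 5) * t < golden * t" "golden * t < (81 / 50) * t"
  using golden_bounds assms by simp_all

lemma golden_squared_left: "golden * (golden * t) = golden * t + t"
  using golden_squared by (simp add: algebra_simps flip: mult.assoc)

text \<open>Together with \<open>algebra_simps\<close>, the two forms of \<open>\<gamma>\<^sup>2 = \<gamma> + 1\<close> reduce every expression to one that is
linear in \<open>a\<close>, \<open>b\<close>, \<open>\<gamma> a\<close>, \<open>\<gamma> b\<close> and \<open>\<gamma>\<close>; the sign conditions below are then linear arithmetic in
these atoms, given bounds such as \<open>triangle_bounds\<close>.\<close>

lemmas golden_simps = algebra_simps golden_squared golden_squared_left

section \<open>The triangle exchange and its self-similarity\<close>

definition triangle :: "(real \<times> real) set" where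
  "triangle = {(a, b). 0 < a \<and> 0 < b \<and> a + b < 1}"

text \<open>In the metric of the invariant form the triangle has its apex of 36 degrees at the origin. The first
branch rotates the obtuse piece by \<open>6 \<cdot> 36\<close> degrees, the last one the acute piece by \<open>4 \<cdot> 36\<close>
degrees; these are the linear parts of \<open>T\<^sup>6\<close> and \<open>T\<^sup>4\<close>. On the line between the
pieces both formulas would lead to the boundary of the triangle; the swap of the coordinates is
what \<open>T\<close> does there.\<close>

definition exchange :: "real \<times> real \<Rightarrow> real \<times> real" where
  "exchange = (\<lambda>(a, b). if a + golden * b < 1 then (b, 1 - a - golden * b)
     else if a + golden * b = 1 then (b, a)
     else (golden - golden * a - b, a))"

lemma triangle_bounds:
  assumes "0 < a" "0 < b" "a + b < 1"
  shows "(8 / 5) * a < golden * a" "golden * a < (81 / 50) * a"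
    "(8 / 5) * b < golden * b" "golden * b < (81 / 50) * b"
    "golden * a + golden * b + (8 / 5) * (1 - a - b) < golden"
    "golden < golden * a + golden * b + (81 / 50) * (1 - a - b)"
proof -
  have "0 < 1 - a - b" using assms by simp
  moreover have "golden * (1 - a - b) = golden - golden * a - golden * b"
    by (simp add: algebra_simps)
  ultimately show "golden * a + golden * b + (8 / 5) * (1 - a - b) < golden"
    "golden < golden * a + golden * b + (81 / 50) * (1 - a - b)"
    using golden_mult_bounds[of "1 - a - b"] by linarith+
qed (use golden_mult_bounds assms in blast)+

lemma exchange_in_triangle:
  assumes "z \<in> triangle" shows "exchange z \<in> triangle"
proof -
  obtain a b where z: "z = (a, b)" by force
  have ab: "0 < a" "0 < b" "a + b < 1" using assms by (auto simp: z triangle_def)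
  have "golden + a < 1 + golden * a + b" if "a + golden * b > 1"
  proof -
    have "0 < (golden - 1) * (a + golden * b - 1)" using that golden_bounds by simp
    then show ?thesis by (simp add: golden_simps)
  qed
  then show ?thesis
    by (auto simp: z exchange_def triangle_def golden_simps; insert ab triangle_bounds[OF ab]; linarith)
qed

lemma funpow_exchange_in_triangle: "z \<in> triangle \<Longrightarrow> (exchange ^^ n) z \<in> triangle"
  by (induction n) (auto intro: exchange_in_triangle)

text \<open>The similarity with ratio \<open>1 / \<gamma>\<close> that takes the triangle with vertices \<open>(0, 0)\<close>, \<open>(1, 0)\<close>, \<open>(0, 1)\<close> to
the acute piece with vertices \<open>(1, 0)\<close>, \<open>(0, 1 / \<gamma>)\<close>, \<open>(0, 1)\<close>. It reverses orientation: the first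
return to the acute piece rotates by \<open>4 \<cdot> 36\<close> degrees where the exchange rotates by
\<open>6 \<cdot> 36\<close>, and vice versa.\<close>

definition shrink :: "real \<times> real \<Rightarrow> real \<times> real" where
  "shrink = (\<lambda>(a, b). (1 - a - b, (golden - 1) * a + b))"

definition acute :: "(real \<times> real) set" where
  "acute = {(a, b) \<in> triangle. 1 < a + golden * b}"

lemma inj_shrink: "inj shrink"
proof (rule injI)
  fix z w :: "real \<times> real"
  assume eq: "shrink z = shrink w"
  obtain a b c d where zw: "z = (a, b)" "w = (c, d)" by force
  have 1: "a + b = c + d" and 2: "golden * a - a + b = golden * c - c + d"
    using eq by (simp_all add: zw shrink_def golden_simps)
  have "(2 - golden) * (a - c) = 0" using 1 2 by (simp add: algebra_simps)
  then have "a = c" using golden_bounds by simp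
  then show "z = w" using 1 by (simp add: zw)
qed

lemma shrink_in_acute:
  assumes "z \<in> triangle" shows "shrink z \<in> acute"
proof -
  obtain a b where z: "z = (a, b)" by force
  have ab: "0 < a" "0 < b" "a + b < 1" using assms by (auto simp: z triangle_def)
  show ?thesis
    by (auto simp: z shrink_def acute_def triangle_def golden_simps; insert ab triangle_bounds[OF ab]; linarith)
qed

text \<open>The inverse of \<open>shrink\<close> has coefficients in \<open>\<int>[\<gamma>]\<close>, so it preserves \<open>\<int>[\<gamma>]\<^sup>2\<close>. The explicit
formula is what is conjugated later on.\<close>

lemma acute_eq_shrink:
  assumes "(p, q) \<in> acute"
  defines "a \<equiv> (golden + 1) * (1 - p - q)" and "b \<equiv> golden * p + (golden + 1) * q - golden"
  shows "(a, b) \<in> triangle" "shrink (a, b) = (p, q)"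
proof -
  have pq: "0 < p" "0 < q" "p + q < 1" "1 < p + golden * q"
    using assms(1) by (auto simp: acute_def triangle_def)
  have "0 < golden * (p + golden * q - 1)" using pq golden_bounds by simp
  moreover have "0 < (golden + 1) * (1 - p - q)" using pq golden_bounds by simp
  moreover note pq
  ultimately show "(a, b) \<in> triangle" by (simp add: triangle_def a_def b_def golden_simps)
  show "shrink (a, b) = (p, q)" by (simp add: shrink_def a_def b_def golden_simps)
qed

definition return_time_shrink :: "real \<times> real \<Rightarrow> nat" where
  "return_time_shrink = (\<lambda>(a, b). if a + golden * b < 1 then 1 else if a + golden * b = 1 then 2 else 3)"

text \<open>The renormalization. After the first step, which uses the rotation of the acute piece, the image of
an obtuse point is back in the acute piece. The image of a point of the line lands on the line and is
reflected, and the image of an acute point makes two further rotations in the obtuse piece.\<close>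

lemma shrink_exchange:
  assumes "z \<in> triangle"
  shows "shrink (exchange z) = (exchange ^^ return_time_shrink z) (shrink z)"
proof -
  obtain a b where z: "z = (a, b)" by force
  have ab: "0 < a" "0 < b" "a + b < 1" using assms by (auto simp: z triangle_def)
  note bnd = triangle_bounds[OF ab] golden_bounds
  define c d where "c = a + (golden - 1) * b" and "d = 1 - a - b"
  have "1 < 1 - a - b + golden * ((golden - 1) * a + b)"
    by (simp add: golden_simps) (use ab bnd in linarith)
  then have RU: "exchange (shrink z) = (c, d)"
    by (simp add: z shrink_def exchange_def c_def d_def) (simp add: golden_simps)
  consider "a + golden * b < 1" | "a + golden * b = 1" | "a + golden * b > 1" by linarith
  then show ?thesis
  proof cases
    case 1
    then show ?thesis using RU
      by (simp add: z return_time_shrink_def) (simp add: shrink_def exchange_def c_def d_def golden_simps)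
  next
    case 2
    then have a: "a = 1 - golden * b" by simp
    have "c + golden * d = 1" by (simp add: a c_def d_def golden_simps)
    then have "exchange (c, d) = (d, c)" by (simp add: exchange_def)
    moreover have "shrink (exchange z) = (d, c)"
      using 2 by (simp add: z exchange_def shrink_def c_def d_def golden_simps)
    ultimately show ?thesis using 2 RU by (simp add: z return_time_shrink_def numeral_2_eq_2)
  next
    case 3
    have "c + golden * d = golden - (golden - 1) * (a + golden * b)"
      by (simp add: c_def d_def golden_simps)
    moreover have "(golden - 1) * 1 < (golden - 1) * (a + golden * b)"
      using 3 golden_bounds by (intro mult_strict_left_mono) simp_all
    ultimately have "c + golden * d < 1" by simp
    then have 4: "exchange (c, d) = (d, 1 - c - golden * d)" by (simp add: exchange_def)
    have "d + golden * (1 - c - golden * d) < 1"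
      by (simp add: c_def d_def golden_simps) (use ab bnd in linarith)
    then have 5: "exchange (d, 1 - c - golden * d) = (1 - c - golden * d, 1 - d - golden * (1 - c - golden * d))"
      by (simp add: exchange_def)
    have "shrink (exchange z) = (1 - c - golden * d, 1 - d - golden * (1 - c - golden * d))"
      using 3 by (simp add: z exchange_def shrink_def c_def d_def golden_simps)
    then show ?thesis using 3 4 5 RU by (simp add: z return_time_shrink_def numeral_3_eq_3)
  qed
qed

lemma finite_orbit_shrink_iff:
  assumes "z \<in> triangle" shows "finite_orbit exchange (shrink z) \<longleftrightarrow> finite_orbit exchange z"
  by (rule finite_orbit_accelerated_iff[symmetric, where A = triangle and n = return_time_shrink])
     (use assms exchange_in_triangle shrink_exchange inj_shrink in
        \<open>auto simp: return_time_shrink_def intro: inj_on_subset\<close>)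

text \<open>Two cases remain once \<open>(b, a)\<close> is not in the acute piece. If \<open>(b, a)\<close> lies on the line, the
point has period at most 2. If it lies in the obtuse piece, three steps lead back to the line, with \<open>b\<close>
replaced by \<open>1 - b\<close>, so the period divides 6.\<close>

lemma finite_orbit_line:
  assumes "(a, b) \<in> triangle" "a + golden * b = 1" "\<And>k. (exchange ^^ k) (a, b) \<notin> acute"
  shows "finite_orbit exchange (a, b)"
proof -
  have a: "a = 1 - golden * b" using assms(2) by simp
  have b: "0 < b" "golden * b < 1" "b < golden * b"
    using assms(1) golden_mult_bounds[of b] by (auto simp: a triangle_def)
  have R1: "exchange (a, b) = (b, a)" using assms(2) by (simp add: exchange_def)
  have "(b, a) \<notin> acute" using assms(3)[of 1] R1 by simp
  moreover have "(b, a) \<in> triangle" using exchange_in_triangle[OF assms(1)] R1 by simp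
  ultimately have "b + golden * a \<le> 1" by (auto simp: acute_def)
  then consider "b + golden * a = 1" | "b + golden * a < 1" by linarith
  then show ?thesis
  proof cases
    case 1
    then have "exchange (b, a) = (a, b)" by (simp add: exchange_def)
    then have "(exchange ^^ 2) (a, b) = (a, b)" using R1 by (simp add: numeral_2_eq_2)
    then show ?thesis by (rule finite_orbit_periodic) simp
  next
    case 2
    have cycle: "(exchange ^^ 3) (1 - golden * t, t) = (1 - golden * (1 - t), 1 - t)"
      if t: "golden - 1 < golden * t" "t < golden * t" "golden * t < 1" for t
    proof -
      have "0 < (golden - 1) * (1 - t)" using t golden_bounds by simp
      then have t': "1 + golden * t < golden + t" by (simp add: algebra_simps)
      have "exchange (1 - golden * t, t) = (t, 1 - golden * t)" by (simp add: exchange_def)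
      moreover have "exchange (t, 1 - golden * t) = (1 - golden * t, golden * t + 1 - golden)"
        using t t' by (simp add: exchange_def golden_simps)
      moreover have "exchange (1 - golden * t, golden * t + 1 - golden) = (golden * t + 1 - golden, 1 - t)"
        using t by (simp add: exchange_def golden_simps)
      ultimately show ?thesis by (simp add: numeral_3_eq_3 algebra_simps)
    qed
    have "golden - 1 < b * golden"  using 2 by (simp add: a golden_simps)
    then have lo: "golden - 1 < golden * b" by (simp add: mult.commute)
    have "b < 1" using b by linarith
    have "(exchange ^^ 3) (a, b) = (1 - golden * (1 - b), 1 - b)"
      unfolding a using lo b by (intro cycle) auto
    moreover have "(exchange ^^ 3) (1 - golden * (1 - b), 1 - b) = (1 - golden * (1 - (1 - b)), 1 - (1 - b))"
      using lo b \<open>b < 1\<close> golden_mult_bounds[of "1 - b", unfolded right_diff_distrib]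
      by (intro cycle) (insert golden_bounds, simp_all add: algebra_simps)
    ultimately have "(exchange ^^ (3 + 3)) (a, b) = (a, b)" by (simp only: flip: funpow_funpow) (simp add: a)
    then show ?thesis by (rule finite_orbit_periodic) simp
  qed
qed

text \<open>An orbit that stays in the obtuse piece consists of consecutive terms of a sequence with
\<open>t\<^bsub>k-1\<^esub> + \<gamma> t\<^bsub>k\<^esub> + t\<^bsub>k+1\<^esub> = 1\<close>. Every such sequence has period 5, because the rotation by
\<open>6 \<cdot> 36\<close> degrees has order 5.\<close>

lemma finite_orbit_if_avoids_acute:
  assumes triangle: "z \<in> triangle" and avoid: "\<And>k. (exchange ^^ k) z \<notin> acute"
  shows "finite_orbit exchange z"
proof (cases "\<exists>k a b. (exchange ^^ k) z = (a, b) \<and> a + golden * b = 1")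
  case True
  then obtain k a b where k: "(exchange ^^ k) z = (a, b)" "a + golden * b = 1" by blast
  have "(a, b) \<in> triangle" using funpow_exchange_in_triangle[OF triangle, of k] k by simp
  moreover have "(exchange ^^ j) (a, b) \<notin> acute" for j
    using avoid[of "j + k"] k(1) by (simp add: funpow_add)
  ultimately have "finite_orbit exchange ((exchange ^^ k) z)"
    using k finite_orbit_line by metis
  then show ?thesis by (simp add: finite_orbit_funpow)
next
  case False
  have step: "exchange (a, b) = (b, 1 - a - golden * b)" if "(exchange ^^ k) z = (a, b)" for k a b
  proof -
    have "(a, b) \<in> triangle" using funpow_exchange_in_triangle[OF triangle, of k] that by simp
    moreover have "(a, b) \<notin> acute" using avoid[of k] that by simp
    ultimately have "a + golden * b \<le> 1" by (auto simp: acute_def)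
    then show ?thesis using False that by (force simp: exchange_def)
  qed
  obtain a b where z: "z = (a, b)" by force
  define c where "c = 1 - a - golden * b"
  define d where "d = 1 - b - golden * c"
  define e where "e = 1 - c - golden * d"
  have "1 - d - golden * e = a" "1 - e - golden * a = b"
    by (simp_all add: c_def d_def e_def golden_simps)
  moreover have "exchange ((exchange ^^ 0) z) = (b, c)" using step[of 0 a b] by (simp add: z c_def)
  moreover from this have "exchange ((exchange ^^ 1) z) = (c, d)" using step[of 1 b c] by (simp add: d_def)
  moreover from this have "exchange ((exchange ^^ 2) z) = (d, e)"
    using step[of 2 c d] by (simp add: e_def numeral_2_eq_2)
  moreover from this have "exchange ((exchange ^^ 3) z) = (e, a)"
    using step[of 3 d e] calculation(1) by (simp add: numeral_2_eq_2 numeral_3_eq_3)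
  moreover from this have "exchange ((exchange ^^ 4) z) = (a, b)"
    using step[of 4 e a] calculation(2) by (simp add: eval_nat_numeral)
  ultimately have "(exchange ^^ 5) z = z" by (simp add: z eval_nat_numeral)
  then show ?thesis by (rule finite_orbit_periodic) simp
qed

section \<open>The exchange as an acceleration of T\<close>

lemma T_eqI:
  assumes "0 \<le> golden * y - x - of_int c" "golden * y - x - of_int c < 1"
    and "golden * y - x - of_int c = t"
  shows "T (x, y) = (y, t)"
proof -
  have "\<lfloor>- x + golden * y\<rfloor> = c" using assms by (intro floor_unique) linarith+
  then show ?thesis using assms(3) by (simp add: T_def frac_def)
qed

text \<open>The coordinates \<open>a = \<gamma> (1 - x)\<close> and \<open>b = \<gamma> y\<close> measure from the corner \<open>(1, 0)\<close>. The
image of the triangle is \<open>{x < 1, y > 0, y < x - \<gamma>\<^sup>-\<^sup>2}\<close>.\<close>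

definition chart :: "real \<times> real \<Rightarrow> real \<times> real" where
  "chart = (\<lambda>(a, b). (1 - (golden - 1) * a, (golden - 1) * b))"

definition return_time_T :: "real \<times> real \<Rightarrow> nat" where
  "return_time_T = (\<lambda>(a, b). if a + golden * b < 1 then 6 else if a + golden * b = 1 then 13 else 4)"

lemma inj_chart: "inj chart"
  using golden_bounds by (auto simp: inj_def chart_def)

text \<open>The whole triangle moves as one piece during the first five steps and has returned after the fourth
one exactly if the point was acute. The sixth step brings the obtuse points back, but
takes the line to the bottom side of the square, from where seven more steps lead back into the triangle.\<close>

lemma chart_exchange:
  assumes "z \<in> triangle"
  shows "chart (exchange z) = (T ^^ return_time_T z) (chart z)"
proof -
  obtain a b where z: "z = (a, b)" by force
  have ab: "0 < a" "0 < b" "a + b < 1" using assms by (auto simp: z triangle_def)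
  note bnd = ab triangle_bounds[OF ab] golden_bounds
  define g where "g = golden - 1"
  have T1: "T (chart z) = (g * b, b + g * a)"
    unfolding z chart_def prod.case g_def
    by (rule T_eqI[where c = "-1"]; simp add: golden_simps; use bnd in linarith)
  have T2: "T (g * b, b + g * a) = (b + g * a, a + b)"
    unfolding g_def by (rule T_eqI[where c = 0]; simp add: golden_simps; use bnd in linarith)
  have T3: "T (b + g * a, a + b) = (a + b, a + g * b)"
    unfolding g_def by (rule T_eqI[where c = 0]; simp add: golden_simps; use bnd in linarith)
  have T4: "T (a + b, a + g * b) = (a + g * b, g * a)"
    unfolding g_def by (rule T_eqI[where c = 0]; simp add: golden_simps; use bnd in linarith)
  have T5: "T (a + g * b, g * a) = (g * a, 1 - g * b)"
    unfolding g_def by (rule T_eqI[where c = "-1"]; simp add: golden_simps; use bnd in linarith)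
  have four: "(T ^^ 4) (chart z) = (a + g * b, g * a)"
    by (simp add: eval_nat_numeral T1 T2 T3 T4)
  have six: "(T ^^ 6) (chart z) = (1 - g * b, g * (1 - a - golden * b))" if "a + golden * b \<le> 1"
  proof -
    have "0 \<le> g * (1 - a - golden * b)" using that golden_bounds by (simp add: g_def)
    then have "T (g * a, 1 - g * b) = (1 - g * b, g * (1 - a - golden * b))"
      unfolding g_def by (intro T_eqI[where c = 1]; simp add: golden_simps; use bnd in linarith)
    then show ?thesis by (simp add: eval_nat_numeral T1 T2 T3 T4 T5)
  qed
  consider "a + golden * b < 1" | "a + golden * b = 1" | "a + golden * b > 1" by linarith
  then show ?thesis
  proof cases
    case 1
    then show ?thesis using six by (simp add: z return_time_T_def exchange_def chart_def g_def)
  next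
    case 3
    then show ?thesis
      using four by (simp add: z return_time_T_def) (simp add: exchange_def chart_def g_def golden_simps)
  next
    case 2
    have "golden * (a + golden * b) = golden" using 2 by simp
    then have ga: "golden * a + golden * b + b = golden" by (simp add: golden_simps)
    have S1: "T (1 - g * b, 0) = (0, g * b)"
      unfolding g_def by (rule T_eqI[where c = "-1"]; simp add: golden_simps; use bnd 2 in linarith)
    have S2: "T (0, g * b) = (g * b, b)"
      unfolding g_def by (rule T_eqI[where c = 0]; simp add: golden_simps; use bnd 2 in linarith)
    have S3: "T (g * b, b) = (b, b)"
      unfolding g_def by (rule T_eqI[where c = 0]; simp add: golden_simps; use bnd 2 in linarith)
    have S4: "T (b, b) = (b, g * b)"
      unfolding g_def by (rule T_eqI[where c = 0]; simp add: golden_simps; use bnd 2 in linarith)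
    have S5: "T (b, g * b) = (g * b, 0)"
      unfolding g_def by (rule T_eqI[where c = 0]; simp add: golden_simps; use bnd 2 in linarith)
    have S6: "T (g * b, 0) = (0, 1 - g * b)"
      unfolding g_def by (rule T_eqI[where c = "-1"]; simp add: golden_simps; use bnd 2 in linarith)
    have S7: "T (0, 1 - g * b) = (1 - g * b, g * a)"
      unfolding g_def by (rule T_eqI[where c = 1]; simp add: golden_simps; use bnd 2 ga in linarith)
    have "(T ^^ 6) (chart z) = (1 - g * b, 0)" using six 2 by (simp add: algebra_simps)
    moreover have "(T ^^ 7) (1 - g * b, 0) = (1 - g * b, g * a)"
      by (simp add: eval_nat_numeral S1 S2 S3 S4 S5 S6 S7)
    ultimately have "(T ^^ (7 + 6)) (chart z) = (1 - g * b, g * a)"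
      by (simp only: flip: funpow_funpow)
    then show ?thesis using 2 by (simp add: z return_time_T_def exchange_def) (simp add: chart_def g_def)
  qed
qed

lemma finite_orbit_chart_iff:
  assumes "z \<in> triangle" shows "finite_orbit T (chart z) \<longleftrightarrow> finite_orbit exchange z"
  by (rule finite_orbit_accelerated_iff[symmetric, where A = triangle and n = return_time_T])
     (use assms exchange_in_triangle chart_exchange inj_chart in
        \<open>auto simp: return_time_T_def intro: inj_on_subset\<close>)

section \<open>Reaching the triangle\<close>

definition settles :: "real \<times> real \<Rightarrow> bool" where
  "settles z \<longleftrightarrow> finite_orbit T z \<or> (\<exists>k. (T ^^ k) z \<in> chart ` triangle)"

lemma settlesI: "p \<in> chart ` triangle \<Longrightarrow> settles p"
  unfolding settles_def by (rule disjI2, rule exI[of _ 0]) simp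

lemma settles_step: "settles (T p) \<Longrightarrow> settles p"
proof -
  assume "settles (T p)"
  then consider "finite_orbit T (T p)" | k where "(T ^^ k) (T p) \<in> chart ` triangle"
    by (auto simp: settles_def)
  then show "settles p"
  proof cases
    case 1
    then show ?thesis by (simp add: settles_def finite_orbit_step)
  next
    case (2 k)
    then have "(T ^^ Suc k) p \<in> chart ` triangle" by (simp add: funpow_swap1)
    then show ?thesis unfolding settles_def by blast
  qed
qed

lemma settles_funpow: "settles ((T ^^ n) p) \<Longrightarrow> settles p"
  by (induction n) (auto dest: settles_step)

lemma in_chart_triangle:
  assumes "x < 1" "0 < y" "y < x - (2 - golden)"
  shows "(x, y) \<in> chart ` triangle"
proof -
  have "golden * (x - y) > golden * (2 - golden)" using assms golden_bounds by simp
  then have "(golden * (1 - x), golden * y) \<in> triangle"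
    using assms golden_bounds by (simp add: triangle_def golden_simps)
  moreover have "chart (golden * (1 - x), golden * y) = (x, y)"
    by (simp add: chart_def golden_simps)
  ultimately show ?thesis by (metis image_eqI)
qed

text \<open>Points on the bottom side are treated separately, since the triangle is open. For \<open>x > \<gamma>\<^sup>-\<^sup>2\<close>
five steps act as the reflection \<open>x \<mapsto> 1 - x\<close> of this side; for smaller \<open>x\<close> two steps
lead into the triangle. The endpoint \<open>\<gamma>\<^sup>-\<^sup>2 = 2 - \<gamma>\<close> has period 7.\<close>

lemma settles_axis:
  assumes "0 < x" "x < 1"
  shows "settles (x, 0)"
proof -
  have co: "golden * x + (8 / 5) * (1 - x) < golden" "golden < golden * x + (81 / 50) * (1 - x)"
    if "x < 1" for x
  proof -
    have "golden * (1 - x) = golden - golden * x" by (simp add: algebra_simps)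
    then show "golden * x + (8 / 5) * (1 - x) < golden" "golden < golden * x + (81 / 50) * (1 - x)"
      using golden_mult_bounds[of "1 - x"] that by linarith+
  qed
  have small: "(T ^^ 2) (x, 0) = (1 - x, golden * (1 - x) - 1)" if "x \<le> 2 - golden" "0 < x" for x
  proof -
    have "golden * x \<le> golden * (2 - golden)" using that golden_bounds by simp
    then have "golden * x \<le> golden - 1" by (simp add: golden_simps)
    moreover note golden_bounds golden_mult_bounds[OF that(2)]
    ultimately have "T (x, 0) = (0, 1 - x)" "T (0, 1 - x) = (1 - x, golden * (1 - x) - 1)"
      using that
      by (intro T_eqI[where c = "-1"] T_eqI[where c = 1]; simp add: algebra_simps; linarith)+
    then show ?thesis by (simp add: numeral_2_eq_2)
  qed
  have flip: "(T ^^ 5) (x, 0) = (1 - x, 0)" if "2 - golden < x" "x < 1" for x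
  proof -
    have "golden * x > golden * (2 - golden)" using that golden_bounds by simp
    then have "golden * x > golden - 1" by (simp add: golden_simps)
    moreover have "0 < x" using that golden_bounds by linarith
    note golden_mult_bounds[OF this]
    moreover note golden_bounds
    moreover note co[OF that(2)]
    ultimately have "T (x, 0) = (0, 1 - x)" "T (0, 1 - x) = (1 - x, golden * (1 - x))"
      "T (1 - x, golden * (1 - x)) = (golden * (1 - x), golden * (1 - x))"
      "T (golden * (1 - x), golden * (1 - x)) = (golden * (1 - x), 1 - x)"
      "T (golden * (1 - x), 1 - x) = (1 - x, 0)"
      using that
      by (intro T_eqI[where c = "-1"] T_eqI[where c = 0]; simp add: golden_simps; linarith)+
    then show ?thesis by (simp add: eval_nat_numeral)
  qed
  have near: "settles (x, 0)" if "0 < x" "x < 2 - golden" for x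
  proof (rule settles_funpow[of 2], rule settlesI)
    have "golden * x < golden * (2 - golden)" using that golden_bounds by simp
    then have "golden * x < golden - 1" by (simp add: golden_simps)
    moreover have "(1 - x, golden * (1 - x) - 1) \<in> chart ` triangle"
      using calculation golden_mult_bounds[OF that(1)] that
      by (intro in_chart_triangle) (simp_all add: algebra_simps)
    ultimately show "(T ^^ 2) (x, 0) \<in> chart ` triangle" using small[of x] that by simp
  qed
  have edge: "settles (2 - golden, 0)"
  proof -
    have "golden * (1 - (2 - golden)) - 1 = 0" by (simp add: golden_simps)
    then have "(T ^^ 2) (2 - golden, 0) = (golden - 1, 0)"
      using small[of "2 - golden"] golden_bounds by simp
    moreover have "(T ^^ 5) (golden - 1, 0) = (2 - golden, 0)"
      using flip[of "golden - 1"] golden_bounds by simp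
    ultimately have "(T ^^ (5 + 2)) (2 - golden, 0) = (2 - golden, 0)"
      by (simp only: flip: funpow_funpow)
    then have "finite_orbit T (2 - golden, 0)" by (rule finite_orbit_periodic) simp
    then show ?thesis by (simp add: settles_def)
  qed
  consider "x < 2 - golden" | "x = 2 - golden" | "2 - golden < x" "x < golden - 1"
    | "golden - 1 \<le> x" by linarith
  then show ?thesis
  proof cases
    case 1
    then show ?thesis using near assms by simp
  next
    case 2
    then show ?thesis using edge by simp
  next
    case 3
    then have "(T ^^ 5) (x, 0) = (1 - x, 0)" "(T ^^ 5) (1 - x, 0) = (x, 0)"
      using flip[of x] flip[of "1 - x"] assms by simp_all
    then have "(T ^^ (5 + 5)) (x, 0) = (x, 0)" by (simp only: flip: funpow_funpow)
    then have "finite_orbit T (x, 0)" by (rule finite_orbit_periodic) simp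
    then show ?thesis by (simp add: settles_def)
  next
    case 4
    then have "(T ^^ 5) (x, 0) = (1 - x, 0)" using flip[of x] assms golden_bounds by simp
    moreover have "settles (1 - x, 0)"
    proof (cases "1 - x = 2 - golden")
      case True
      then show ?thesis by (simp only: edge)
    qed (use 4 assms near[of "1 - x"] in simp)
    ultimately show ?thesis by (metis settles_funpow)
  qed
qed

text \<open>Two steps take the points below the line \<open>\<gamma> y = x\<close> that lie neither in the triangle nor on the
bottom side to one of these two places.\<close>

lemma settles_below:
  assumes "0 \<le> y" "golden * y < x" "x < 1"
  shows "settles (x, y)"
proof -
  have y: "y \<le> golden * y" using assms golden_bounds by (simp add: mult_le_cancel_right1)
  have x: "x < golden * x"
    using assms y golden_mult_bounds[of x] by auto
  consider "y = 0" | "0 < y" "y < x - (2 - golden)" | "x - (2 - golden) \<le> y" using assms by linarith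
  then show ?thesis
  proof cases
    case 1
    then show ?thesis using assms settles_axis by simp
  next
    case 2
    then show ?thesis using assms by (intro settlesI in_chart_triangle)
  next
    case 3
    have "golden * (x - (2 - golden)) \<le> golden * y" using 3 golden_bounds by simp
    then have lo: "golden * x \<le> golden * y + golden - 1" by (simp add: golden_simps)
    have hi: "golden * y < golden * x" using assms y golden_bounds by simp
    define u v where "u = golden * y - x + 1" and "v = golden * (y - x + 1) - 1"
    have "T (x, y) = (y, u)" unfolding u_def
      by (rule T_eqI[where c = "-1"]) (use assms y in auto)
    moreover have "T (y, u) = (u, v)" unfolding u_def v_def
      using lo hi golden_bounds by (intro T_eqI[where c = 1]; simp add: golden_simps; linarith)
    ultimately have T2: "(T ^^ 2) (x, y) = (u, v)" by (simp add: numeral_2_eq_2)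
    have uv: "0 < u" "u < 1" "0 \<le> v" "v < u - (2 - golden)"
      by (simp_all add: u_def v_def algebra_simps) (use assms y lo x in linarith)+
    have "settles (u, v)"
    proof (cases "v = 0")
      case True
      then show ?thesis using uv settles_axis by simp
    next
      case False
      then show ?thesis using uv by (intro settlesI in_chart_triangle) auto
    qed
    then show ?thesis using T2 by (metis settles_funpow)
  qed
qed

lemma not_settles_step:
  assumes "\<not> settles (x, y)" "0 \<le> x" "x < 1" "0 \<le> y" "y < 1"
  shows "0 \<le> golden * y - x" "golden * y - x < 1" "\<not> settles (y, golden * y - x)"
proof -
  show lo: "0 \<le> golden * y - x" using settles_below[of y x] assms by force
  show hi: "golden * y - x < 1"
  proof (rule ccontr)
    assume "\<not> golden * y - x < 1"
    then have top: "1 \<le> golden * y - x" by simp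
    have "golden * y < 2 * 1" using assms golden_bounds by (intro mult_strict_mono') simp_all
    then have "T (x, y) = (y, golden * y - x - 1)"
      using top assms by (intro T_eqI[where c = 1]) simp_all
    moreover have "settles (y, golden * y - x - 1)"
    proof (rule settles_below)
      have "golden * y < golden * (1 + x)" using assms golden_bounds by simp
      then show "golden * (golden * y - x - 1) < y" by (simp add: golden_simps)
    qed (use top assms in simp_all)
    ultimately show False using assms(1) settles_step by metis
  qed
  have "T (x, y) = (y, golden * y - x)" using lo hi by (intro T_eqI[where c = 0]) simp_all
  then show "\<not> settles (y, golden * y - x)" using assms(1) settles_step by metis
qed

text \<open>A point that does not settle follows the linear recurrence \<open>x\<^bsub>k+1\<^esub> = \<gamma> x\<^bsub>k\<^esub> - x\<^bsub>k-1\<^esub>\<close> without any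
reduction modulo 1. But five steps of it are the rotation by 180 degrees, so \<open>- x\<^bsub>0\<^esub>\<close> and \<open>- x\<^bsub>1\<^esub>\<close>
are nonnegative too, and the point is the fixed point \<open>(0, 0)\<close>.\<close>

lemma settles_unit_square:
  assumes "z \<in> unit_square" shows "settles z"
proof (rule ccontr)
  assume no: "\<not> settles z"
  obtain x0 x1 where z: "z = (x0, x1)" by force
  have sq: "0 \<le> x0" "x0 < 1" "0 \<le> x1" "x1 < 1" using assms by (auto simp: z unit_square_def)
  define x2 where "x2 = golden * x1 - x0"
  define x3 where "x3 = golden * x2 - x1"
  define x4 where "x4 = golden * x3 - x2"
  note s2 = not_settles_step[OF no[unfolded z] sq, folded x2_def]
  note s3 = not_settles_step[OF s2(3) sq(3,4) s2(1,2), folded x3_def]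
  note s4 = not_settles_step[OF s3(3) s2(1,2) s3(1,2), folded x4_def]
  note s5 = not_settles_step[OF s4(3) s3(1,2) s4(1,2)]
  note s6 = not_settles_step(1)[OF s5(3) s4(1,2) s5(1,2)]
  have x5: "golden * x4 - x3 = - x0" by (simp add: x2_def x3_def x4_def golden_simps)
  then have "x0 = 0" using s5(1) sq(1) by simp
  moreover have "golden * (golden * x4 - x3) - x4 = - x1"
    by (simp add: x2_def x3_def x4_def golden_simps)
  then have "x1 = 0" using s6 sq(3) by simp
  ultimately have "T z = z" by (simp add: z T_def)
  then have "finite_orbit T z" using finite_orbit_periodic[of 1 T z] by simp
  then show False using no by (simp add: settles_def)
qed

section \<open>Points with coordinates in \<int>[\<gamma>]\<close>

text \<open>The Galois conjugation of \<open>\<int>[\<gamma>]\<close> as a relation, which makes the compatibility with the ring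
operations immediate. That the conjugate is unique comes down to \<open>conjugates_0_iff\<close>.\<close>

definition conjugates :: "real \<Rightarrow> real \<Rightarrow> bool" where
  "conjugates x x' \<longleftrightarrow>
     (\<exists>m n :: int. x = of_int m + of_int n * golden \<and> x' = of_int m + of_int n * (1 - golden))"

lemma conjugates_of_int: "conjugates (of_int m) (of_int m)"
  unfolding conjugates_def by (rule exI[of _ m], rule exI[of _ 0]) simp

lemma conjugates_1: "conjugates 1 1"
  using conjugates_of_int[of 1] by simp

lemma conjugates_golden: "conjugates golden (1 - golden)"
  unfolding conjugates_def by (rule exI[of _ 0], rule exI[of _ 1]) simp

lemma conjugates_add:
  assumes "conjugates x x'" "conjugates y y'"
  shows "conjugates (x + y) (x' + y')"
proof -
  obtain k l m n :: int where "x = of_int k + of_int l * golden" "x' = of_int k + of_int l * (1 - golden)"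
    "y = of_int m + of_int n * golden" "y' = of_int m + of_int n * (1 - golden)"
    using assms unfolding conjugates_def by blast
  then have "x + y = of_int (k + m) + of_int (l + n) * golden"
    "x' + y' = of_int (k + m) + of_int (l + n) * (1 - golden)"
    by (simp_all add: algebra_simps)
  then show ?thesis unfolding conjugates_def by blast
qed

lemma conjugates_mult:
  assumes "conjugates x x'" "conjugates y y'"
  shows "conjugates (x * y) (x' * y')"
proof -
  obtain k l m n :: int where xy: "x = of_int k + of_int l * golden" "x' = of_int k + of_int l * (1 - golden)"
    "y = of_int m + of_int n * golden" "y' = of_int m + of_int n * (1 - golden)"
    using assms unfolding conjugates_def by blast
  have "x * y = of_int (k * m + l * n) + of_int (k * n + l * m + l * n) * golden"
    "x' * y' = of_int (k * m + l * n) + of_int (k * n + l * m + l * n) * (1 - golden)"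
    unfolding xy by (simp_all add: golden_simps)
  then show ?thesis unfolding conjugates_def by blast
qed

lemma conjugates_diff:
  assumes "conjugates x x'" "conjugates y y'"
  shows "conjugates (x - y) (x' - y')"
  using conjugates_add[OF assms(1) conjugates_mult[OF conjugates_of_int[of "-1"] assms(2)]] by simp

lemmas conjugates_intros = conjugates_1 conjugates_golden conjugates_add conjugates_diff conjugates_mult

text \<open>The norm form of \<open>\<int>[\<gamma>]\<close> has no nontrivial zero. After division by the common divisor, \<open>k\<close> divides
\<open>l\<^sup>2\<close> and is coprime to \<open>l\<close>, so it is a unit; then the same holds for \<open>l\<close> and for one of its two
neighbours, which is impossible.\<close>

lemma norm_form_eq_0:
  fixes m n :: int
  assumes "m * m + m * n = n * n"
  shows "m = 0 \<and> n = 0"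
proof (rule ccontr)
  assume "\<not> (m = 0 \<and> n = 0)"
  define d where "d = gcd m n"
  have d: "d \<noteq> 0" using \<open>\<not> (m = 0 \<and> n = 0)\<close> by (simp add: d_def)
  then obtain k l where kl: "m = k * d" "n = l * d" "coprime k l"
    using gcd_coprime_exists[of m n] unfolding d_def by blast
  have "(d * d) * (k * (k + l)) = (d * d) * (l * l)"
    using assms by (simp add: kl(1,2) algebra_simps)
  then have eq: "k * (k + l) = l * l" using d by simp
  then have "k dvd l * l" by (metis dvd_triv_left)
  moreover have "coprime k (l * l)" using kl(3) by simp
  ultimately have "is_unit k" using coprime_common_divisor[of k "l * l" k] by simp
  then have "k = 1 \<or> k = -1" by (auto simp: abs_if split: if_splits)
  then have "l * (l - 1) = 1 \<or> l * (l + 1) = 1" using eq by (auto simp: algebra_simps)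
  then show False by (auto simp: zmult_eq_1_iff)
qed

lemma conjugates_0_iff: "conjugates 0 x' \<longleftrightarrow> x' = 0"
proof
  assume "conjugates 0 x'"
  then obtain m n :: int where 0: "of_int m + of_int n * golden = 0"
    and x': "x' = of_int m + of_int n * (1 - golden)"
    by (auto simp: conjugates_def)
  have "real_of_int (m * m + m * n - n * n)
      = (of_int m + of_int n * golden) * (of_int m + of_int n * (1 - golden))"
    by (simp add: golden_simps)
  then have "real_of_int (m * m + m * n - n * n) = 0" using 0 by simp
  then have "m * m + m * n = n * n" by linarith
  then have "m = 0 \<and> n = 0" by (rule norm_form_eq_0)
  then show "x' = 0" using x' by simp
qed (use conjugates_of_int[of 0] in simp)

lemma mem_int_adjoin_golden_iff: "x \<in> int_adjoin golden \<longleftrightarrow> (\<exists>x'. conjugates x x')"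
  by (auto simp: int_adjoin_golden conjugates_def)

text \<open>The five values of the periodic sequence with \<open>t\<^bsub>k-1\<^esub> + w t\<^bsub>k\<^esub> + t\<^bsub>k+1\<^esub> = 1\<close> that starts with \<open>a\<close>, \<open>b\<close>,
where \<open>w\<^sup>2 = w + 1\<close>. A step in the obtuse piece only shifts this sequence and a step on the line only
reverses it. So the size of the set of its values measures conjugate coordinates in a way that these steps
do not change, although they move the coordinates by affine maps with different centres.\<close>

definition pentagon :: "real \<Rightarrow> real \<times> real \<Rightarrow> real set" where
  "pentagon w = (\<lambda>(a, b). {a, b, 1 - a - w * b, w * (a + b) + 1 - w, 1 - w * a - b})"

text \<open>Distances are taken from \<open>1 / 2\<close> since this is the centre of the interval \<open>[- \<gamma>, \<gamma>\<^sup>2]\<close> to which the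
conjugate values are attracted under repeated pull-back.\<close>

definition conj_bounded :: "real \<Rightarrow> real \<times> real \<Rightarrow> bool" where
  "conj_bounded r z \<longleftrightarrow> (\<exists>a' b'. conjugates (fst z) a' \<and> conjugates (snd z) b' \<and>
     (\<forall>t \<in> pentagon (1 - golden) (a', b'). \<bar>t - 1 / 2\<bar> \<le> r))"

lemma conj_bounded_mono: "conj_bounded r z \<Longrightarrow> r \<le> s \<Longrightarrow> conj_bounded s z"
  unfolding conj_bounded_def by (meson order_trans)

lemma pentagon_shift:
  assumes "w * w = w + 1"
  shows "pentagon w (b, 1 - a - w * b) = pentagon w (a, b)"
proof -
  have w: "w * (w * x) = w * x + x" for x :: real
    using assms by (simp add: distrib_right flip: mult.assoc)
  have "1 - b - w * (1 - a - w * b) = w * (a + b) + 1 - w"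
    "w * (b + (1 - a - w * b)) + 1 - w = 1 - w * a - b"
    "1 - w * b - (1 - a - w * b) = a"
    by (simp_all add: algebra_simps w assms)
  then show ?thesis unfolding pentagon_def by auto
qed

lemma pentagon_swap:
  assumes "a + w * b = 1"
  shows "pentagon w (b, a) = pentagon w (a, b)"
proof -
  have "1 - a - w * b = 0" "1 - w * b - a = 0" "w * (b + a) + 1 - w = w * (a + b) + 1 - w"
    "1 - b - w * a = 1 - w * a - b"
    using assms by (simp_all add: algebra_simps)
  then show ?thesis unfolding pentagon_def by auto
qed

text \<open>On the line the swap preserves the pentagon of the conjugates because the equation \<open>a + \<gamma> b = 1\<close> can
be conjugated, by \<open>conjugates_0_iff\<close>.\<close>

lemma conj_bounded_exchange:
  assumes z: "z \<in> triangle" "z \<notin> acute" and bd: "conj_bounded r z"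
  shows "conj_bounded r (exchange z)"
proof -
  obtain a b where ab: "z = (a, b)" by force
  obtain a' b' where conj: "conjugates a a'" "conjugates b b'"
    and r: "\<forall>t \<in> pentagon (1 - golden) (a', b'). \<bar>t - 1 / 2\<bar> \<le> r"
    using bd by (auto simp: conj_bounded_def ab)
  have "a + golden * b \<le> 1" using z by (auto simp: ab acute_def)
  then consider "a + golden * b < 1" | "a + golden * b = 1" by linarith
  then show ?thesis
  proof cases
    case 1
    have "conjugates (1 - a - golden * b) (1 - a' - (1 - golden) * b')"
      by (intro conjugates_intros conj)
    moreover have "(1 - golden) * (1 - golden) = (1 - golden) + 1" by (simp add: golden_simps)
    note pentagon_shift[OF this, of b' a']
    ultimately show ?thesis
      using 1 conj r by (auto simp: ab exchange_def conj_bounded_def)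
  next
    case 2
    have "conjugates (a + golden * b - 1) (a' + (1 - golden) * b' - 1)"
      by (intro conjugates_intros conj)
    then have "a' + (1 - golden) * b' = 1" using 2 by (simp add: conjugates_0_iff)
    note pentagon_swap[OF this]
    then show ?thesis
      using 2 conj r by (auto simp: ab exchange_def conj_bounded_def)
  qed
qed

text \<open>The pull-back of a pentagon with the values \<open>s\<close> has values of the form \<open>w (1 - s)\<close>, \<open>- w s\<close> and
\<open>1 - w s\<close>. For the conjugate \<open>w = - 1 / \<gamma>\<close> this is a contraction.\<close>

lemma pentagon_inverse_shrink:
  fixes w p q :: real
  assumes "w * w = w + 1"
  defines "a \<equiv> (w + 1) * (1 - p - q)" and "b \<equiv> w * p + (w + 1) * q - w"
  shows "pentagon w (a, b)
    = {w * (1 - (w * (p + q) + 1 - w)), - w * (1 - p - w * q), 1 - w * q, 1 - w * p, - w * (1 - w * p - q)}"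
proof -
  have w: "w * (w * x) = w * x + x" for x :: real
    using assms(1) by (simp add: distrib_right flip: mult.assoc)
  have eqs: "a = w * (1 - (w * (p + q) + 1 - w))" "b = - w * (1 - p - w * q)"
    "1 - a - w * b = 1 - w * q" "w * (a + b) + 1 - w = 1 - w * p"
    "1 - w * a - b = - w * (1 - w * p - q)"
    by (simp_all add: a_def b_def algebra_simps w assms(1))
  show ?thesis
    by (simp only: pentagon_def prod.case eqs(3-5)) (simp only: eqs(1,2))
qed

text \<open>The constants are upper bounds for the contraction factor \<open>1 / \<gamma>\<close> and for the shift \<open>\<gamma> / 2\<close>
of the deviation from \<open>1 / 2\<close>.\<close>

lemma conj_bounded_inverse_shrink:
  assumes bd: "conj_bounded r (p, q)"
  defines "a \<equiv> (golden + 1) * (1 - p - q)" and "b \<equiv> golden * p + (golden + 1) * q - golden"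
  shows "conj_bounded (31 / 50 * r + 81 / 100) (a, b)"
proof -
  obtain p' q' where conj: "conjugates p p'" "conjugates q q'"
    and r: "\<And>t. t \<in> pentagon (1 - golden) (p', q') \<Longrightarrow> \<bar>t - 1 / 2\<bar> \<le> r"
    using bd by (auto simp: conj_bounded_def)
  define w where "w = 1 - golden"
  define a' where "a' = (w + 1) * (1 - p' - q')"
  define b' where "b' = w * p' + (w + 1) * q' - w"
  have w: "w * w = w + 1" by (simp add: w_def golden_simps)
  have ab: "conjugates a a'" "conjugates b b'"
    unfolding a_def b_def a'_def b'_def w_def by (intro conjugates_intros conj)+
  have contract: "\<bar>w * (s - 1 / 2)\<bar> \<le> 31 / 50 * r" if "s \<in> pentagon w (p', q')" for s
  proof -
    have "\<bar>w\<bar> \<le> 31 / 50" using golden_bounds by (simp add: w_def)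
    moreover have "\<bar>s - 1 / 2\<bar> \<le> r" using r that by (simp add: w_def)
    ultimately show ?thesis unfolding abs_mult by (intro mult_mono) simp_all
  qed
  have "\<bar>t - 1 / 2\<bar> \<le> 31 / 50 * r + 81 / 100" if "t \<in> pentagon w (a', b')" for t
  proof -
    have "t \<in> {w * (1 - (w * (p' + q') + 1 - w)), - w * (1 - p' - w * q'), 1 - w * q', 1 - w * p',
        - w * (1 - w * p' - q')}"
      using that pentagon_inverse_shrink[OF w, of p' q'] by (simp add: a'_def b'_def)
    then obtain s where s: "s \<in> pentagon w (p', q')"
      and t: "t = w * (1 - s) \<or> t = - w * s \<or> t = 1 - w * s"
      unfolding pentagon_def by blast
    define e where "e = w * (s - 1 / 2)"
    have center: "w * (1 - s) = - e + w / 2" "- w * s = - e - w / 2"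
      by (simp_all add: e_def field_simps)
    have "\<bar>e\<bar> \<le> 31 / 50 * r" using contract[OF s] by (simp add: e_def)
    then have e: "- (31 / 50 * r) \<le> e" "e \<le> 31 / 50 * r" by linarith+
    have w_bounds: "- (62 / 100) \<le> w" "w \<le> 0" using golden_bounds by (simp_all add: w_def)
    consider "t = - e + w / 2" | "t = - e - w / 2" | "t = 1 - e - w / 2"
      using t center by force
    then show ?thesis
    proof cases
      case 1
      show ?thesis unfolding 1 using e w_bounds by (intro abs_leI) linarith+
    next
      case 2
      show ?thesis unfolding 2 using e w_bounds by (intro abs_leI) linarith+
    next
      case 3
      show ?thesis unfolding 3 using e w_bounds by (intro abs_leI) linarith+
    qed
  qed
  then show ?thesis using ab unfolding conj_bounded_def w_def by auto
qed

text \<open>The difference of \<open>m + n \<gamma>\<close> and its conjugate is \<open>n\<close> times \<open>2 \<gamma> - 1 = sqrt 5\<close>, and the hypotheses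
keep it below \<open>4.4 < 2 sqrt 5\<close>. So \<open>n\<close> is at most 1 in absolute value, and \<open>n = 0\<close> would
make \<open>a\<close> an integer.\<close>

lemma small_conjugate:
  assumes "conjugates a a'" "0 < a" "a < 1" "\<bar>a' - 1 / 2\<bar> \<le> 39 / 10"
  shows "a = golden - 1 \<or> a = 2 - golden"
proof -
  obtain m n :: int where a: "a = of_int m + of_int n * golden" and a': "a' = of_int m + of_int n * (1 - golden)"
    using assms(1) by (auto simp: conjugates_def)
  have "a - a' = of_int n * (2 * golden - 1)" by (simp add: a a' algebra_simps)
  then have "\<bar>a - a'\<bar> = \<bar>real_of_int n\<bar> * (2 * golden - 1)"
    using golden_bounds by (simp add: abs_mult)
  then have abs: "\<bar>real_of_int n\<bar> * (2 * golden - 1) < 44 / 10"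
    using assms by linarith
  have "\<bar>n\<bar> < 2"
  proof (rule ccontr)
    assume "\<not> \<bar>n\<bar> < 2"
    then have "2 \<le> \<bar>real_of_int n\<bar>" by linarith
    then have "2 * (22 / 10) \<le> \<bar>real_of_int n\<bar> * (2 * golden - 1)"
      using golden_bounds by (intro mult_mono) simp_all
    then show False using abs by simp
  qed
  then consider "n = 0" | "n = 1" | "n = -1" by linarith
  then show ?thesis
  proof cases
    case 1
    then show ?thesis using assms a by simp
  next
    case 2
    then have "- 2 < real_of_int m" "real_of_int m < 0" using assms(2,3) a golden_bounds by simp_all
    then have "m = -1" by linarith
    then show ?thesis using 2 a by simp
  next
    case 3
    then have "1 < real_of_int m" "real_of_int m < 3" using assms(2,3) a golden_bounds by simp_all
    then have "m = 2" by linarith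
    then show ?thesis using 3 a by simp
  qed
qed

text \<open>Induction on the size of the conjugates. Each pull-back reduces the bound by at least \<open>1 / 2\<close>, since
\<open>31 / 50 r + 81 / 100 \<le> r - 1 / 2\<close> for \<open>r \<ge> 4.4\<close>. In the base case \<open>small_conjugate\<close> leaves two values
for each coordinate, and \<open>a + b < 1\<close> leaves only the fixed point \<open>(2 - \<gamma>, 2 - \<gamma>)\<close>.\<close>

lemma finite_orbit_if_conj_bounded:
  assumes "z \<in> triangle" "conj_bounded (39 / 10 + real k / 2) z"
  shows "finite_orbit exchange z"
  using assms
proof (induction k arbitrary: z)
  case 0
  obtain a b where z: "z = (a, b)" by force
  have ab: "0 < a" "0 < b" "a + b < 1" using 0 by (auto simp: z triangle_def)
  obtain a' b' where "conjugates a a'" "conjugates b b'" "\<bar>a' - 1 / 2\<bar> \<le> 39 / 10" "\<bar>b' - 1 / 2\<bar> \<le> 39 / 10"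
    using 0(2) by (auto simp: conj_bounded_def pentagon_def z)
  then have "a = golden - 1 \<or> a = 2 - golden" "b = golden - 1 \<or> b = 2 - golden"
    using ab small_conjugate[of a a'] small_conjugate[of b b'] by auto
  then have eqs: "a = 2 - golden" "b = 2 - golden" using ab golden_bounds by auto
  have "a + golden * b = 1" unfolding eqs by (simp add: golden_simps)
  then have "exchange z = z" using eqs by (simp add: z exchange_def)
  then show ?case using finite_orbit_periodic[of 1 exchange z] by simp
next
  case (Suc k)
  let ?r = "39 / 10 + real (Suc k) / 2"
  show ?case
  proof (cases "\<exists>j. (exchange ^^ j) z \<in> acute")
    case False
    then show ?thesis using finite_orbit_if_avoids_acute Suc.prems(1) by blast
  next
    case True
    define j where "j = (LEAST j. (exchange ^^ j) z \<in> acute)"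
    have j: "(exchange ^^ j) z \<in> acute" and before: "\<And>i. i < j \<Longrightarrow> (exchange ^^ i) z \<notin> acute"
      using True unfolding j_def by (auto intro: LeastI_ex dest: not_less_Least)
    have "conj_bounded ?r ((exchange ^^ i) z)" if "i \<le> j" for i
      using that
    proof (induction i)
      case 0
      show ?case using Suc.prems(2) by simp
    next
      case (Suc i)
      then show ?case
        using conj_bounded_exchange[OF funpow_exchange_in_triangle before] \<open>z \<in> triangle\<close> by simp
    qed
    then have bd: "conj_bounded ?r ((exchange ^^ j) z)" by simp
    obtain p q where pq: "(exchange ^^ j) z = (p, q)" by force
    define a where "a = (golden + 1) * (1 - p - q)"
    define b where "b = golden * p + (golden + 1) * q - golden"
    have ab: "(a, b) \<in> triangle" "shrink (a, b) = (p, q)"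
      using acute_eq_shrink[of p q] j by (simp_all add: pq a_def b_def)
    have "conj_bounded (31 / 50 * ?r + 81 / 100) (a, b)"
      using conj_bounded_inverse_shrink bd unfolding pq a_def b_def by blast
    then have "conj_bounded (39 / 10 + real k / 2) (a, b)"
      by (rule conj_bounded_mono) (simp add: field_simps)
    then have "finite_orbit exchange (a, b)" using ab(1) by (rule Suc.IH[rotated])
    then have "finite_orbit exchange ((exchange ^^ j) z)" using finite_orbit_shrink_iff ab pq by metis
    then show ?thesis by (simp add: finite_orbit_funpow)
  qed
qed

lemma conj_bounded_exists:
  assumes "conjugates (fst z) a'" "conjugates (snd z) b'"
  shows "\<exists>k. conj_bounded (39 / 10 + real k / 2) z"
proof -
  let ?P = "pentagon (1 - golden) (a', b')"
  have "finite ?P" by (simp add: pentagon_def)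
  then obtain r where r: "\<forall>t \<in> ?P. \<bar>t - 1 / 2\<bar> \<le> r"
    using bdd_above_finite[of "(\<lambda>t. \<bar>t - 1 / 2\<bar>) ` ?P"] by (auto simp: bdd_above_def)
  obtain k :: nat where "2 * r \<le> real k" using real_arch_simple by blast
  then have "\<forall>t \<in> ?P. \<bar>t - 1 / 2\<bar> \<le> 39 / 10 + real k / 2" using r by fastforce
  then show ?thesis using assms unfolding conj_bounded_def by blast
qed

lemma finite_orbit_T_int_adjoin:
  assumes z: "z \<in> unit_square" "fst z \<in> int_adjoin golden" "snd z \<in> int_adjoin golden"
  shows "finite_orbit T z"
proof -
  have "fst ((T ^^ k) z) \<in> int_adjoin golden \<and> snd ((T ^^ k) z) \<in> int_adjoin golden" for k
  proof (induction k)
    case 0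
    show ?case using z by simp
  next
    case (Suc k)
    obtain x y where xy: "(T ^^ k) z = (x, y)" by force
    then obtain x' y' where "conjugates x x'" "conjugates y y'"
      using Suc by (auto simp: mem_int_adjoin_golden_iff)
    then have "conjugates (golden * y - x - of_int \<lfloor>- x + golden * y\<rfloor>)
        ((1 - golden) * y' - x' - of_int \<lfloor>- x + golden * y\<rfloor>)"
      by (intro conjugates_intros conjugates_of_int)
    then have "frac (- x + golden * y) \<in> int_adjoin golden"
      unfolding mem_int_adjoin_golden_iff frac_def by (auto simp: algebra_simps)
    moreover have "(T ^^ Suc k) z = (y, frac (- x + golden * y))" by (simp add: xy) (simp add: T_def)
    ultimately show ?case using Suc by (simp add: xy)
  qed
  note adj = this
  consider "finite_orbit T z" | k w where "(T ^^ k) z = chart w" "w \<in> triangle"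
    using settles_unit_square[OF z(1)] by (auto simp: settles_def)
  then show ?thesis
  proof cases
    case (2 k w)
    obtain a b where w: "w = (a, b)" by force
    obtain x' y' where conj: "conjugates (1 - (golden - 1) * a) x'" "conjugates ((golden - 1) * b) y'"
      using adj[of k] 2(1) by (auto simp: w chart_def mem_int_adjoin_golden_iff)
    have "a = golden * (1 - (1 - (golden - 1) * a))" "b = golden * ((golden - 1) * b)"
      by (simp_all add: golden_simps)
    then have "conjugates a ((1 - golden) * (1 - x'))" "conjugates b ((1 - golden) * y')"
      using conjugates_intros conj by metis+
    then obtain m where "conj_bounded (39 / 10 + real m / 2) w"
      using conj_bounded_exists[of w] w by auto
    then have "finite_orbit T ((T ^^ k) z)"
      using finite_orbit_if_conj_bounded finite_orbit_chart_iff 2 by metis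
    then show ?thesis by (simp add: finite_orbit_funpow)
  qed
qed

section \<open>The aperiodic point\<close>

lemma exchange_acute:
  assumes "(a, b) \<in> acute"
  shows "exchange (a, b) = (golden - golden * a - b, a)"
  using assms by (auto simp: acute_def exchange_def)

lemma exchange_shrink_not_acute:
  assumes "1 \<le> a + golden * b" "(a, b) \<in> triangle"
  shows "exchange (shrink (a, b)) \<notin> acute"
proof -
  have "shrink (a, b) \<in> acute" using assms(2) by (rule shrink_in_acute)
  then have exchange: "exchange (shrink (a, b))
      = (golden - golden * (1 - a - b) - ((golden - 1) * a + b), 1 - a - b)"
    by (simp add: shrink_def exchange_acute)
  have "golden - golden * (1 - a - b) - ((golden - 1) * a + b) + golden * (1 - a - b)
      = 1 - (golden - 1) * (a + golden * b - 1)"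
    by (simp add: golden_simps)
  also have "\<dots> \<le> 1" using assms(1) golden_bounds by simp
  finally show ?thesis by (simp add: exchange acute_def)
qed

text \<open>The similarity embeds the orbit of \<open>z\<close> into the orbit of \<open>shrink z\<close>. The embedding is not onto if the
orbit of \<open>z\<close> leaves the obtuse piece, since then the larger orbit leaves the acute piece
(\<open>exchange_shrink_not_acute\<close>), in which the embedded orbit lies.\<close>

lemma card_orbit_shrink:
  assumes triangle: "z \<in> triangle" and fin: "finite_orbit exchange z"
    and visit: "(exchange ^^ k) z = (a, b)" "1 \<le> a + golden * b"
  shows "card (forward_orbit exchange z) < card (forward_orbit exchange (shrink z))"
proof -
  let ?O = "forward_orbit exchange z" and ?V = "forward_orbit exchange (shrink z)"
  have finV: "finite ?V" using finite_orbit_shrink_iff[OF triangle] fin by (simp add: finite_orbit_def)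
  have sub: "shrink ` ?O \<subseteq> ?V"
    by (rule orbit_image_subset[where n = return_time_shrink])
       (rule shrink_exchange[OF funpow_exchange_in_triangle[OF triangle]])
  have "shrink (a, b) \<in> ?V" using sub visit(1) by (metis image_subset_iff rangeI)
  then obtain m where "shrink (a, b) = (exchange ^^ m) (shrink z)" by blast
  then have "exchange (shrink (a, b)) \<in> ?V"
    using rangeI[of "\<lambda>n. (exchange ^^ n) (shrink z)" "Suc m"] by simp
  moreover have "exchange (shrink (a, b)) \<notin> acute"
    using exchange_shrink_not_acute[OF visit(2)]
      funpow_exchange_in_triangle[OF triangle, of k] visit(1) by simp
  moreover have "shrink ` ?O \<subseteq> acute"
    using shrink_in_acute funpow_exchange_in_triangle[OF triangle] by blast
  ultimately have "shrink ` ?O \<subset> ?V" using sub by blast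
  then have "card (shrink ` ?O) < card ?V" using finV by (rule psubset_card_mono[rotated])
  then show ?thesis by (simp add: card_image inj_on_subset[OF inj_shrink])
qed

lemma card_orbit_funpow_le:
  assumes "finite_orbit exchange z"
  shows "card (forward_orbit exchange ((exchange ^^ k) z)) \<le> card (forward_orbit exchange z)"
  using assms orbit_funpow_subset unfolding finite_orbit_def by (intro card_mono)

text \<open>The first point after \<open>(1/4, 1/2)\<close> is \<open>w\<close>. Entering the acute piece and pulling back leads from \<open>w\<close> to \<open>u\<close>,
from \<open>u\<close> to \<open>v\<close> and from \<open>v\<close> back to \<open>w\<close>. Each of the three orbits enters the acute piece, so each pull-back would
strictly decrease the size of a finite orbit.\<close>

lemma infinite_orbit_quarter: "\<not> finite_orbit exchange (1 / 4, 1 / 2)"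
proof
  assume "finite_orbit exchange (1 / 4, 1 / 2)"
  define u v w where "u = ((2 - golden) / 4, (2 - golden) / 2)"
    and "v = ((2 * golden - 1) / 4, 1 / 4 :: real)"
    and "w = ((3 * golden - 2) / 4, 1 / 4 :: real)"
  let ?N = "\<lambda>z. card (forward_orbit exchange z)"
  have "exchange (1 / 4, 1 / 2) = w"
    using golden_bounds by (simp add: exchange_def w_def field_simps)
  then have fin_w: "finite_orbit exchange w"
    using \<open>finite_orbit exchange (1 / 4, 1 / 2)\<close> finite_orbit_step by metis
  have triangle: "u \<in> triangle" "v \<in> triangle" "w \<in> triangle"
    using golden_bounds by (auto simp: u_def v_def w_def triangle_def field_simps)
  have w: "w = shrink u" by (simp add: u_def w_def shrink_def) (simp add: field_simps golden_squared golden_squared_left)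
  have next_u: "(2 - golden) / 4 + golden * ((2 - golden) / 2) = golden / 4"
    "1 - (2 - golden) / 4 - golden * ((2 - golden) / 2) = 1 - golden / 4"
    by (simp_all add: field_simps golden_squared golden_squared_left)
  have "exchange u = ((2 - golden) / 2, 1 - golden / 4)"
    unfolding u_def exchange_def prod.case next_u using golden_bounds by simp
  also have "\<dots> = shrink v" by (simp add: v_def shrink_def) (simp add: field_simps golden_squared golden_squared_left)
  finally have u: "(exchange ^^ 1) u = shrink v" by simp
  have next_v: "1 / 4 + golden * ((5 - 3 * golden) / 4) = (golden - 1) / 2"
    "1 - 1 / 4 - golden * ((5 - 3 * golden) / 4) = 1 - (golden - 1) / 2"
    by (simp_all add: field_simps golden_squared golden_squared_left)
  have "exchange v = (1 / 4, (5 - 3 * golden) / 4)"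
    using golden_bounds by (simp add: v_def exchange_def field_simps)
  moreover have "exchange (1 / 4, (5 - 3 * golden) / 4) = ((5 - 3 * golden) / 4, 1 - (golden - 1) / 2)"
    unfolding exchange_def prod.case next_v using golden_bounds by simp
  moreover have "\<dots> = shrink w" by (simp add: w_def shrink_def) (simp add: field_simps golden_squared golden_squared_left)
  ultimately have v: "(exchange ^^ 2) v = shrink w" by (simp add: numeral_2_eq_2)
  have fin_u: "finite_orbit exchange u" using fin_w w finite_orbit_shrink_iff[OF triangle(1)] by simp
  have fin_v: "finite_orbit exchange v"
    using fin_u u finite_orbit_shrink_iff[OF triangle(2)] finite_orbit_funpow by metis
  have acute: "1 \<le> fst z + golden * snd z" if "z = shrink y" "y \<in> triangle" for y z
    using shrink_in_acute[OF that(2)] that(1) by (auto simp: acute_def)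
  have "?N u < ?N w"
    unfolding w using triangle(1) fin_u u[THEN trans, OF surjective_pairing] acute[OF refl triangle(2)]
    by (rule card_orbit_shrink)
  also have "?N w < ?N (shrink w)"
    using triangle(3) fin_w _ acute[OF w triangle(1)] by (rule card_orbit_shrink[where k = 0]) simp
  also have "?N (shrink w) \<le> ?N v" using card_orbit_funpow_le[OF fin_v, of 2] v by simp
  also have "?N v < ?N (shrink v)"
    using triangle(2) fin_v v[THEN trans, OF surjective_pairing] acute[OF refl triangle(3)]
    by (rule card_orbit_shrink)
  also have "?N (shrink v) \<le> ?N u" using card_orbit_funpow_le[OF fin_u, of 1] u by simp
  finally show False by simp
qed

theorem theorem7p2:
  shows "(\<forall>z \<in> (int_adjoin golden \<inter> {0..<1}) \<times> (int_adjoin golden \<inter> {0..<1}). min_period T z < \<infinity>)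
       \<and> aperiodic (\<lambda>k. int_iterate unit_square T k (1 / 4, 1 / (4 * golden ^ 3)))"
proof
  show "\<forall>z \<in> (int_adjoin golden \<inter> {0..<1}) \<times> (int_adjoin golden \<inter> {0..<1}). min_period T z < \<infinity>"
  proof
    fix z assume "z \<in> (int_adjoin golden \<inter> {0..<1}) \<times> (int_adjoin golden \<inter> {0..<1})"
    then have z: "z \<in> unit_square" "fst z \<in> int_adjoin golden" "snd z \<in> int_adjoin golden"
      by (auto simp: unit_square_def)
    show "min_period T z < \<infinity>"
      using min_period_finite_iff[OF bij_betw_T z(1)] finite_orbit_T_int_adjoin[OF z] by simp
  qed
next
  \<comment> \<open>the second iterate is the point of the triangle with the coordinates \<open>(1/4, 1/2)\<close>\<close>
  have "(2 * golden - 3) * golden ^ 3 = 1" by (simp add: golden_simps power3_eq_cube)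
  then have y: "1 / (4 * golden ^ 3) = (2 * golden - 3) / 4"
    using golden_bounds by (simp add: field_simps)
  have sq: "(1 / 4, (2 * golden - 3) / 4) \<in> unit_square"
    using golden_bounds by (simp add: unit_square_def)
  have triangle: "(1 / 4, 1 / 2) \<in> triangle" by (simp add: triangle_def)
  have "T (1 / 4, (2 * golden - 3) / 4) = ((2 * golden - 3) / 4, (5 - golden) / 4)"
    using golden_bounds by (intro T_eqI[where c = "-1"]; simp add: field_simps golden_squared golden_squared_left)
  moreover have "T ((2 * golden - 3) / 4, (5 - golden) / 4) = ((5 - golden) / 4, (golden - 1) / 2)"
    using golden_bounds by (intro T_eqI[where c = 1]; simp add: field_simps golden_squared golden_squared_left)
  moreover have "chart (1 / 4, 1 / 2) = ((5 - golden) / 4, (golden - 1) / 2)"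
    by (simp add: chart_def field_simps)
  ultimately have "(T ^^ 2) (1 / 4, (2 * golden - 3) / 4) = chart (1 / 4, 1 / 2)"
    by (simp add: numeral_2_eq_2)
  then have "\<not> finite_orbit T (1 / 4, (2 * golden - 3) / 4)"
    using finite_orbit_chart_iff[OF triangle] infinite_orbit_quarter finite_orbit_funpow by metis
  then have "\<not> min_period T (1 / 4, (2 * golden - 3) / 4) < \<infinity>"
    using min_period_finite_iff[OF bij_betw_T sq] by simp
  then show "aperiodic (\<lambda>k. int_iterate unit_square T k (1 / 4, 1 / (4 * golden ^ 3)))"
    unfolding y aperiodic_int_iterate_iff[OF bij_betw_T sq] by simp
qed

end
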